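(* Let $X$ be a zero-dimensional Hausdorff space. The following statements are equivalent: (1) $X$ is an almost $P$-space. (2) Every maximal ideal in $C_c(X)$ is a $z^0$-ideal. (3) Every fixed maximal ideal in $C_c(X)$ is a $z^0$-ideal. (4) Every $z$-ideal in $C_c(X)$ is a $z^0$-ideal.
   Context: A space is zero-dimensional if its clopen sets form a base for its topology. $C_c(X)$ is the ring of real-valued continuous functions on $X$ with countable range. $X$ is an almost $P$-space if every nonempty zero set $Z(f)=\{x: f(x)=0\}$, $f$ a real-valued continuous function on $X$, has nonempty interior. Ideals are always proper. An ideal of $C_c(X)$ is fixed if there is a point of $X$ at which all its members vanish. For a commutative reduced ring $R$ with unity and $a\in R$, let $M_a$ be the intersection of all maximal ideals of $R$ containing $a$, and $\mathcal P_a$ the intersection of all minimal prime ideals of $R$ containing $a$ (an empty intersection being $R$). An ideal $I$ of $R$ is a $z$-ideal if $M_a\subseteq I$ for every $a\in I$, and a $z^0$-ideal if $\mathcal P_a\subseteq I$ for every $a\in I$. *)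

theory Defs
  imports "HOL-Analysis.Analysis" "HOL-Algebra.Ideal"
begin

definition zero_dimensional_space :: "'a topology \<Rightarrow> bool" where
  "zero_dimensional_space X \<longleftrightarrow>
     openin X = arbitrary union_of (\<lambda>U. openin X U \<and> closedin X U)"

definition zero_set :: "'a topology \<Rightarrow> ('a \<Rightarrow> real) \<Rightarrow> 'a set" where
  "zero_set X f = {x \<in> topspace X. f x = 0}"

definition almost_P_space :: "'a topology \<Rightarrow> bool" where
  "almost_P_space X \<longleftrightarrow>
     (\<forall>f. continuous_map X euclideanreal f \<longrightarrow> zero_set X f \<noteq> {} \<longrightarrow>
          X interior_of zero_set X f \<noteq> {})"

(* Members are made extensional outside topspace X, so that functions agreeing on the
   space are equal as elements of the ring. *)
definition Cc :: "'a topology \<Rightarrow> ('a \<Rightarrow> real) ring" where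
  "Cc X =
    \<lparr>carrier = {f \<in> extensional (topspace X).
                  continuous_map X euclideanreal f \<and> countable (f ` topspace X)},
     mult = (\<lambda>f g. \<lambda>x\<in>topspace X. f x * g x),
     one = (\<lambda>x\<in>topspace X. 1),
     zero = (\<lambda>x\<in>topspace X. 0),
     add = (\<lambda>f g. \<lambda>x\<in>topspace X. f x + g x)\<rparr>"

definition fixed_ideal :: "'a topology \<Rightarrow> ('a \<Rightarrow> real) set \<Rightarrow> bool" where
  "fixed_ideal X I \<longleftrightarrow> (\<exists>x\<in>topspace X. \<forall>f\<in>I. f x = 0)"

definition proper_ideal :: "'a set \<Rightarrow> ('a, 'b) ring_scheme \<Rightarrow> bool" where
  "proper_ideal I R \<longleftrightarrow> ideal I R \<and> I \<noteq> carrier R"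

definition minimal_primeideal :: "'a set \<Rightarrow> ('a, 'b) ring_scheme \<Rightarrow> bool" where
  "minimal_primeideal P R \<longleftrightarrow>
     primeideal P R \<and> (\<forall>Q. primeideal Q R \<longrightarrow> Q \<subseteq> P \<longrightarrow> Q = P)"

(* Intersecting with carrier R makes an empty intersection equal to R. *)
definition max_hull :: "('a, 'b) ring_scheme \<Rightarrow> 'a \<Rightarrow> 'a set" where
  "max_hull R a = carrier R \<inter> \<Inter>{M. maximalideal M R \<and> a \<in> M}"

definition minprime_hull :: "('a, 'b) ring_scheme \<Rightarrow> 'a \<Rightarrow> 'a set" where
  "minprime_hull R a = carrier R \<inter> \<Inter>{P. minimal_primeideal P R \<and> a \<in> P}"

definition z_ideal :: "'a set \<Rightarrow> ('a, 'b) ring_scheme \<Rightarrow> bool" where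
  "z_ideal I R \<longleftrightarrow> proper_ideal I R \<and> (\<forall>a\<in>I. max_hull R a \<subseteq> I)"

definition z0_ideal :: "'a set \<Rightarrow> ('a, 'b) ring_scheme \<Rightarrow> bool" where
  "z0_ideal I R \<longleftrightarrow> proper_ideal I R \<and> (\<forall>a\<in>I. minprime_hull R a \<subseteq> I)"

end

theory Submission
  imports Defs "HOL-Algebra.Ring_Divisibility"
begin

text \<open>In \<open>C\<^sub>c(X)\<close> an element \<open>g\<close> whose zero set contains that of \<open>f\<close> lies in every
  maximal ideal containing \<open>f\<close>. If \<open>X\<close> is almost \<open>P\<close> and \<open>a x = 0 \<noteq> g x\<close>, then some nonempty
  clopen \<open>W\<close> satisfies \<open>a = 0\<close> and \<open>g \<noteq> 0\<close> on \<open>W\<close>; a minimal prime inside the point ideal of some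
  \<open>y \<in> W\<close> contains \<open>a\<close>, since it misses the indicator of \<open>W\<close>, but not \<open>g\<close>. So for every \<open>a\<close> the
  minimal-prime hull lies inside the maximal hull, which gives (4).
  Conversely, if \<open>X\<close> is not almost \<open>P\<close>, a nonempty zero set with empty interior can be shrunk
  to the zero set of some \<open>a\<close> in \<open>C\<^sub>c(X)\<close>. Such an \<open>a\<close> is regular and hence in no minimal prime,
  so no proper ideal containing it is a \<open>z\<^sup>0\<close>-ideal, although it lies in a point ideal.\<close>

section \<open>Prime ideals in commutative rings\<close>

lemma (in ring) mem_add_cgenideal_iff:
  "y \<in> I <+> PIdl a \<longleftrightarrow> (\<exists>i\<in>I. \<exists>x\<in>carrier R. y = i \<oplus> x \<otimes> a)"
  unfolding set_add_def' cgenideal_def by blast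

lemma (in cring) ideal_add_cgenideal:
  assumes "ideal I R" "a \<in> carrier R"
  shows "ideal (I <+> PIdl a) R" "I \<subseteq> I <+> PIdl a" "a \<in> I <+> PIdl a"
proof -
  interpret ideal I R by fact
  show "ideal (I <+> PIdl a) R"
    using assms by (simp add: add_ideals cgenideal_ideal)
  show "I \<subseteq> I <+> PIdl a"
  proof
    fix i assume "i \<in> I"
    then have "i = i \<oplus> \<zero> \<otimes> a"
      using assms(2) by simp
    with \<open>i \<in> I\<close> show "i \<in> I <+> PIdl a"
      unfolding mem_add_cgenideal_iff by blast
  qed
  have "a = \<zero> \<oplus> \<one> \<otimes> a"
    using assms(2) by simp
  then show "a \<in> I <+> PIdl a"
    unfolding mem_add_cgenideal_iff by (metis one_closed zero_closed)
qed

text \<open>By maximality \<open>M\<close> together with \<open>g\<close> generates the whole ring,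
  so the unit splits accordingly.\<close>

lemma (in cring) maximalideal_comaximal:
  assumes "maximalideal M R" "g \<in> carrier R" "g \<notin> M"
  obtains m h where "m \<in> M" "h \<in> carrier R" "m \<oplus> h \<otimes> g = \<one>"
proof -
  interpret maximalideal M R by fact
  note J = ideal_add_cgenideal[OF is_ideal assms(2)]
  have "M <+> PIdl g = carrier R"
    using I_maximal[OF J(1,2)] J(3) assms(3) ideal.Icarr[OF J(1)] by blast
  then have "\<one> \<in> M <+> PIdl g"
    by simp
  then show ?thesis
    using that unfolding mem_add_cgenideal_iff by metis
qed

text \<open>An ideal maximal among those disjoint from \<open>S\<close> is prime. Zorn's lemma
  supplies one, since the zero ideal avoids \<open>S\<close> by
  \<open>\<zero> \<notin> S\<close>.\<close>

lemma (in cring) primeideal_disjoint_submonoid: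
  assumes S: "S \<subseteq> carrier R" "\<one> \<in> S" "\<zero> \<notin> S"
    and mult: "\<And>s t. s \<in> S \<Longrightarrow> t \<in> S \<Longrightarrow> s \<otimes> t \<in> S"
  obtains Q where "primeideal Q R" "Q \<inter> S = {}"
proof -
  let ?A = "{I. ideal I R \<and> I \<inter> S = {}}"
  have "\<exists>M\<in>?A. \<forall>I\<in>?A. M \<subseteq> I \<longrightarrow> I = M"
  proof (rule subset_Zorn_nonempty)
    show "?A \<noteq> {}"
      using S zeroideal by blast
    fix C assume C: "C \<noteq> {}" "subset.chain ?A C"
    then have "subset.chain {I. ideal I R} C"
      unfolding subset_chain_def by blast
    then have "ideal (\<Union>C) R"
      using chain_Union_is_ideal[of C] C(1) by simp
    then show "\<Union>C \<in> ?A"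
      using C unfolding subset_chain_def by blast
  qed
  then obtain Q where "Q \<in> ?A" and "\<forall>I\<in>?A. Q \<subseteq> I \<longrightarrow> I = Q"
    by (rule bexE)
  then have Q: "ideal Q R" "Q \<inter> S = {}"
    and max: "\<And>I. ideal I R \<Longrightarrow> I \<inter> S = {} \<Longrightarrow> Q \<subseteq> I \<Longrightarrow> I = Q"
    by simp_all
  interpret Q: ideal Q R by fact
  \<comment> \<open>Adjoining \<open>a\<close> to \<open>Q\<close> gives a strictly larger ideal,
    which by maximality can no longer avoid \<open>S\<close>.\<close>
  have meets: "\<exists>i\<in>Q. \<exists>x\<in>carrier R. i \<oplus> x \<otimes> a \<in> S" if "a \<in> carrier R" "a \<notin> Q" for a
  proof -
    note J = ideal_add_cgenideal[OF Q(1) that(1)]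
    have "(Q <+> PIdl a) \<inter> S \<noteq> {}"
      using max[OF J(1) _ J(2)] J(3) that(2) by blast
    then show ?thesis
      using mem_add_cgenideal_iff by auto
  qed
  have "primeideal Q R"
  proof (rule primeidealI[OF Q(1) is_cring])
    show "carrier R \<noteq> Q"
      using S Q(2) by auto
    fix a b assume ab: "a \<in> carrier R" "b \<in> carrier R" "a \<otimes> b \<in> Q"
    show "a \<in> Q \<or> b \<in> Q"
    proof (rule ccontr)
      assume "\<not> (a \<in> Q \<or> b \<in> Q)"
      then obtain i x j y where
        ix: "i \<in> Q" "x \<in> carrier R" "i \<oplus> x \<otimes> a \<in> S" and
        jy: "j \<in> Q" "y \<in> carrier R" "j \<oplus> y \<otimes> b \<in> S"
        using meets ab by metis
      define u v where "u = x \<otimes> a" and "v = y \<otimes> b"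
      have carr: "i \<in> carrier R" "j \<in> carrier R" "u \<in> carrier R" "v \<in> carrier R"
        using ix jy ab Q.Icarr by (auto simp: u_def v_def)
      have "u \<otimes> v = (a \<otimes> b) \<otimes> (x \<otimes> y)"
        using ab ix jy by (simp add: u_def v_def m_ac)
      then have "u \<otimes> v \<in> Q"
        using ab(3) ix jy by (simp add: Q.I_r_closed)
      \<comment> \<open>The product of the two elements of \<open>S\<close> is grouped so that each
        summand has a factor in \<open>Q\<close>: first \<open>i\<close>, then \<open>j\<close>,
        then \<open>u \<otimes> v\<close> itself.\<close>
      then have "i \<otimes> (j \<oplus> v) \<oplus> (u \<otimes> j \<oplus> u \<otimes> v) \<in> Q"
        using carr ix(1) jy(1) by (simp add: Q.I_l_closed Q.I_r_closed)
      also have "i \<otimes> (j \<oplus> v) \<oplus> (u \<otimes> j \<oplus> u \<otimes> v) = (i \<oplus> u) \<otimes> (j \<oplus> v)"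
        using carr by (simp add: l_distr r_distr a_ac)
      finally show False
        using mult[OF ix(3) jy(3)] Q(2) unfolding u_def v_def by blast
    qed
  qed
  then show ?thesis
    using that Q(2) by blast
qed

text \<open>Zorn's lemma applied downwards: the intersection of a nonempty chain of prime ideals is
  prime.\<close>

lemma (in cring) minimal_primeideal_below:
  assumes P: "primeideal P R"
  obtains Q where "minimal_primeideal Q R" "Q \<subseteq> P"
proof -
  let ?B = "{Q. primeideal Q R \<and> Q \<subseteq> P}"
  \<comment> \<open>Complements reverse inclusion, so a maximal element among them is the complement
    of a minimal prime.\<close>
  have "\<exists>M\<in>uminus ` ?B. \<forall>I\<in>uminus ` ?B. M \<subseteq> I \<longrightarrow> I = M"
  proof (rule subset_Zorn_nonempty)
    show "uminus ` ?B \<noteq> {}"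
      using P by blast
    fix C assume C: "C \<noteq> {}" "subset.chain (uminus ` ?B) C"
    define D where "D = uminus ` C"
    have D: "D \<noteq> {}" "\<And>Q. Q \<in> D \<Longrightarrow> primeideal Q R \<and> Q \<subseteq> P"
      and chain: "\<And>Q Q'. Q \<in> D \<Longrightarrow> Q' \<in> D \<Longrightarrow> Q \<subseteq> Q' \<or> Q' \<subseteq> Q"
      using C unfolding D_def subset_chain_def by fastforce+
    have "primeideal (\<Inter>D) R"
    proof (rule primeidealI[OF _ is_cring])
      show "ideal (\<Inter>D) R"
        using D primeideal.axioms(1) by (intro i_Intersect) auto
      show "carrier R \<noteq> \<Inter>D"
      proof
        assume "carrier R = \<Inter>D"
        then have "carrier R \<subseteq> P"
          using D by blast
        then show False
          using primeideal.I_notcarr[OF P] ideal.Icarr[OF primeideal.axioms(1)[OF P]] by blast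
      qed
      fix a b assume ab: "a \<in> carrier R" "b \<in> carrier R" "a \<otimes> b \<in> \<Inter>D"
      show "a \<in> \<Inter>D \<or> b \<in> \<Inter>D"
      proof (rule ccontr)
        assume "\<not> (a \<in> \<Inter>D \<or> b \<in> \<Inter>D)"
        then obtain Q Q' where "Q \<in> D" "a \<notin> Q" "Q' \<in> D" "b \<notin> Q'"
          by blast
        \<comment> \<open>The smaller of \<open>Q\<close> and \<open>Q'\<close> omits both
          \<open>a\<close> and \<open>b\<close>.\<close>
        then obtain Q'' where "Q'' \<in> D" "a \<notin> Q''" "b \<notin> Q''"
          using chain by blast
        then show False
          using ab D(2) primeideal.I_prime[of Q'' R a b] by blast
      qed
    qed
    moreover have "\<Inter>D \<subseteq> P"
      using D by blast
    moreover have "\<Union>C = - \<Inter>D"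
      unfolding D_def by auto
    ultimately show "\<Union>C \<in> uminus ` ?B"
      by blast
  qed
  then obtain Q where Q: "primeideal Q R" "Q \<subseteq> P"
    and min: "\<And>I. primeideal I R \<Longrightarrow> I \<subseteq> P \<Longrightarrow> I \<subseteq> Q \<Longrightarrow> I = Q"
    by (auto simp: image_iff)
  then show ?thesis
    using that[of Q] unfolding minimal_primeideal_def by blast
qed

text \<open>A localization argument without fractions. Regularity of \<open>a\<close> keeps zero out
  of the submonoid generated by \<open>a\<close> and the complement of \<open>P\<close>, so some
  prime ideal avoids this submonoid. It lies in \<open>P\<close>, hence equals \<open>P\<close> by
  minimality, and yet misses \<open>a\<close>.\<close>

lemma (in cring) minimal_primeideal_no_regular:
  assumes P: "minimal_primeideal P R" and a: "a \<in> carrier R"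
    and reg: "\<And>c. c \<in> carrier R \<Longrightarrow> a \<otimes> c = \<zero> \<Longrightarrow> c = \<zero>"
  shows "a \<notin> P"
proof
  assume "a \<in> P"
  interpret P: primeideal P R
    using P by (simp add: minimal_primeideal_def)
  define S where "S = {a [^] n \<otimes> c |(n::nat) c. c \<in> carrier R - P}"
  have one: "\<one> \<in> carrier R - P"
    using P.I_notcarr P.one_imp_carrier by auto
  \<comment> \<open>Powers of \<open>a\<close> are regular as well, so
    \<open>a [^] n \<otimes> c\<close> vanishes only for \<open>c = \<zero>\<close>, which is in
    \<open>P\<close>. This gives \<open>\<zero> \<notin> S\<close>.\<close>
  have pow: "c = \<zero>" if "c \<in> carrier R" "a [^] n \<otimes> c = \<zero>" for c and n :: nat
    using that
  proof (induction n arbitrary: c)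
    case 0
    then show ?case by simp
  next
    case (Suc n)
    then have "a [^] n \<otimes> (a \<otimes> c) = \<zero>"
      using a by (simp add: m_assoc)
    then show ?case
      using Suc a reg by blast
  qed
  have subS: "c \<in> S" if "c \<in> carrier R - P" for c
    unfolding S_def using that by (auto intro!: exI[of _ "0::nat"] exI[of _ c])
  have aS: "a \<in> S"
    unfolding S_def using a one by (auto intro!: exI[of _ "1::nat"] exI[of _ \<one>])
  obtain Q where Q: "primeideal Q R" "Q \<inter> S = {}"
  proof (rule primeideal_disjoint_submonoid[of S])
    show "S \<subseteq> carrier R"
      unfolding S_def using a by auto
    show "\<one> \<in> S"
      using subS one by blast
    show "\<zero> \<notin> S"
      unfolding S_def using pow P.zero_closed by force
    fix s t assume "s \<in> S" "t \<in> S"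
    then obtain m n :: nat and c d where
      s: "s = a [^] m \<otimes> c" "c \<in> carrier R - P" and t: "t = a [^] n \<otimes> d" "d \<in> carrier R - P"
      unfolding S_def by blast
    have "s \<otimes> t = a [^] (m + n) \<otimes> (c \<otimes> d)"
      using s t a by (simp add: nat_pow_mult[symmetric] m_ac)
    moreover have "c \<otimes> d \<in> carrier R - P"
      using s t P.I_prime by auto
    ultimately show "s \<otimes> t \<in> S"
      unfolding S_def by blast
  qed
  have "Q \<subseteq> P"
    using Q subS ideal.Icarr[OF primeideal.axioms(1)[OF Q(1)]] by blast
  then have "Q = P"
    using P Q(1) unfolding minimal_primeideal_def by blast
  then show False
    using \<open>a \<in> P\<close> aS Q(2) by blast
qed

section \<open>The ring of continuous functions with countable range\<close>

lemma Cc_simps: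
  "f \<in> carrier (Cc X) \<longleftrightarrow>
     f \<in> extensional (topspace X) \<and> continuous_map X euclideanreal f \<and> countable (f ` topspace X)"
  "f \<otimes>\<^bsub>Cc X\<^esub> g = (\<lambda>x\<in>topspace X. f x * g x)"
  "f \<oplus>\<^bsub>Cc X\<^esub> g = (\<lambda>x\<in>topspace X. f x + g x)"
  "\<one>\<^bsub>Cc X\<^esub> = (\<lambda>x\<in>topspace X. 1)"
  "\<zero>\<^bsub>Cc X\<^esub> = (\<lambda>x\<in>topspace X. 0)"
  by (simp_all add: Cc_def)

lemma Cc_closed_restrict:
  assumes "continuous_map X euclideanreal f" "countable (f ` topspace X)"
  shows "restrict f (topspace X) \<in> carrier (Cc X)"
  using assms by (simp add: Cc_simps)

lemma Cc_eqI:
  assumes "f \<in> carrier (Cc X)" "g \<in> carrier (Cc X)" "\<And>x. x \<in> topspace X \<Longrightarrow> f x = g x"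
  shows "f = g"
  using assms by (auto simp: Cc_simps intro: extensionalityI)

lemma countable_image_binop:
  assumes "countable (f ` A)" "countable (g ` A)"
  shows "countable ((\<lambda>x. h (f x) (g x)) ` A)"
proof (rule countable_subset)
  show "(\<lambda>x. h (f x) (g x)) ` A \<subseteq> (\<lambda>(u, v). h u v) ` (f ` A \<times> g ` A)"
    by force
  show "countable ((\<lambda>(u, v). h u v) ` (f ` A \<times> g ` A))"
    using assms by blast
qed

lemma Cc_add_closed:
  "f \<in> carrier (Cc X) \<Longrightarrow> g \<in> carrier (Cc X) \<Longrightarrow> f \<oplus>\<^bsub>Cc X\<^esub> g \<in> carrier (Cc X)"
  unfolding Cc_simps(3) by (rule Cc_closed_restrict)
    (auto simp: Cc_simps intro: continuous_intros countable_image_binop)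

lemma Cc_mult_closed:
  "f \<in> carrier (Cc X) \<Longrightarrow> g \<in> carrier (Cc X) \<Longrightarrow> f \<otimes>\<^bsub>Cc X\<^esub> g \<in> carrier (Cc X)"
  unfolding Cc_simps(2) by (rule Cc_closed_restrict)
    (auto simp: Cc_simps intro: continuous_intros countable_image_binop)

lemma Cc_const_closed: "(\<lambda>x\<in>topspace X. c) \<in> carrier (Cc X)"
  by (rule Cc_closed_restrict) (auto intro: countable_subset[of _ "{c}"])

lemma Cc_apply:
  assumes "x \<in> topspace X"
  shows "(f \<otimes>\<^bsub>Cc X\<^esub> g) x = f x * g x" "(f \<oplus>\<^bsub>Cc X\<^esub> g) x = f x + g x"
    "\<one>\<^bsub>Cc X\<^esub> x = 1" "\<zero>\<^bsub>Cc X\<^esub> x = 0"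
  using assms by (simp_all add: Cc_simps)

lemma Cc_cring: "cring (Cc X)"
proof (intro cringI abelian_groupI comm_monoidI)
  fix f assume f: "f \<in> carrier (Cc X)"
  have "(\<lambda>x\<in>topspace X. - f x) \<in> carrier (Cc X)"
  proof (rule Cc_closed_restrict)
    show "continuous_map X euclideanreal (\<lambda>x. - f x)"
      using f by (auto simp: Cc_simps intro: continuous_intros)
    show "countable ((\<lambda>x. - f x) ` topspace X)"
      using f countable_image[of "f ` topspace X" uminus] by (simp add: Cc_simps image_image)
  qed
  moreover have "(\<lambda>x\<in>topspace X. - f x) \<oplus>\<^bsub>Cc X\<^esub> f = \<zero>\<^bsub>Cc X\<^esub>"
    by (simp add: Cc_simps fun_eq_iff)
  ultimately show "\<exists>g\<in>carrier (Cc X). g \<oplus>\<^bsub>Cc X\<^esub> f = \<zero>\<^bsub>Cc X\<^esub>"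
    by blast
  \<comment> \<open>The unit laws need extensionality of \<open>f\<close>: outside the space both
    sides must be \<open>undefined\<close>.\<close>
  show "\<zero>\<^bsub>Cc X\<^esub> \<oplus>\<^bsub>Cc X\<^esub> f = f" "\<one>\<^bsub>Cc X\<^esub> \<otimes>\<^bsub>Cc X\<^esub> f = f"
    using f by (auto simp: Cc_simps fun_eq_iff restrict_def extensional_def)
qed (auto simp: Cc_add_closed[unfolded Cc_simps(3)] Cc_mult_closed[unfolded Cc_simps(2)]
    Cc_const_closed Cc_simps(2-5) fun_eq_iff algebra_simps)

text \<open>The kernel of evaluation at \<open>x\<close>.\<close>

definition point_ideal :: "'a topology \<Rightarrow> 'a \<Rightarrow> ('a \<Rightarrow> real) set" where
  "point_ideal X x = {f \<in> carrier (Cc X). f x = 0}"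

text \<open>A strictly larger ideal contains some \<open>g\<close> with
  \<open>g x \<noteq> 0\<close>. A constant multiple \<open>u\<close> of it has value 1 at
  \<open>x\<close>, so \<open>1 - u\<close> lies in the point ideal and the unit in the larger
  ideal.\<close>

lemma point_ideal_maximal:
  assumes x: "x \<in> topspace X"
  shows "maximalideal (point_ideal X x) (Cc X)"
proof -
  interpret cring "Cc X" by (rule Cc_cring)
  have neg: "(\<ominus>\<^bsub>Cc X\<^esub> f) x = - f x" if "f \<in> carrier (Cc X)" for f
    using fun_cong[OF r_neg[OF that], of x] x by (simp add: Cc_apply)
  have "ideal (point_ideal X x) (Cc X)"
  proof (rule idealI[OF ring_axioms])
    show "subgroup (point_ideal X x) (add_monoid (Cc X))"
    proof (rule add.subgroupI)
      show "point_ideal X x \<noteq> {}"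
        using zero_closed Cc_apply(4)[OF x] unfolding point_ideal_def by blast
    qed (use x in \<open>auto simp: point_ideal_def neg Cc_apply\<close>)
  qed (use x in \<open>auto simp: point_ideal_def Cc_apply\<close>)
  moreover have "\<one>\<^bsub>Cc X\<^esub> \<notin> point_ideal X x"
    by (simp add: point_ideal_def Cc_apply x)
  then have "carrier (Cc X) \<noteq> point_ideal X x"
    using one_closed by metis
  moreover have "J = carrier (Cc X)"
    if J: "ideal J (Cc X)" "point_ideal X x \<subseteq> J" "J \<noteq> point_ideal X x" for J
  proof -
    interpret J: ideal J "Cc X" by fact
    obtain g where g: "g \<in> J" "g x \<noteq> 0"
      using J J.Icarr unfolding point_ideal_def by blast
    define u where "u = (\<lambda>y\<in>topspace X. 1 / g x) \<otimes>\<^bsub>Cc X\<^esub> g"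
    have u: "u \<in> J" "u x = 1"
      using g x by (auto simp: u_def J.I_l_closed Cc_const_closed Cc_apply)
    have uC: "u \<in> carrier (Cc X)"
      using u(1) by (rule J.Icarr)
    have "\<one>\<^bsub>Cc X\<^esub> \<oplus>\<^bsub>Cc X\<^esub> (\<ominus>\<^bsub>Cc X\<^esub> u) \<in> point_ideal X x"
      using u(2) uC x by (simp add: point_ideal_def Cc_apply neg)
    then have "(\<one>\<^bsub>Cc X\<^esub> \<oplus>\<^bsub>Cc X\<^esub> (\<ominus>\<^bsub>Cc X\<^esub> u)) \<oplus>\<^bsub>Cc X\<^esub> u \<in> J"
      using u(1) J(2) by (blast intro: J.a_closed)
    then have "\<one>\<^bsub>Cc X\<^esub> \<in> J"
      using uC by (simp add: a_assoc l_neg)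
    then show ?thesis
      by (rule J.one_imp_carrier)
  qed
  ultimately show ?thesis
    by (intro maximalidealI) auto
qed

text \<open>If \<open>1 = m + h g\<close> with \<open>m \<in> M\<close>, then \<open>f\<^sup>2 + m\<^sup>2 \<in> M\<close> has no zeros,
  hence is a unit.\<close>

lemma maximalideal_zero_set:
  assumes M: "maximalideal M (Cc X)" and f: "f \<in> M" and g: "g \<in> carrier (Cc X)"
    and sub: "zero_set X f \<subseteq> zero_set X g"
  shows "g \<in> M"
proof (rule ccontr)
  assume "g \<notin> M"
  interpret cring "Cc X" by (rule Cc_cring)
  interpret M: maximalideal M "Cc X" by fact
  obtain m h where m: "m \<in> M" "h \<in> carrier (Cc X)" and eq: "m \<oplus>\<^bsub>Cc X\<^esub> h \<otimes>\<^bsub>Cc X\<^esub> g = \<one>\<^bsub>Cc X\<^esub>"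
    using maximalideal_comaximal[OF M g \<open>g \<notin> M\<close>] .
  define u where "u = f \<otimes>\<^bsub>Cc X\<^esub> f \<oplus>\<^bsub>Cc X\<^esub> m \<otimes>\<^bsub>Cc X\<^esub> m"
  have uM: "u \<in> M"
    unfolding u_def using f m by (simp add: M.I_r_closed M.a_closed M.Icarr)
  then have uC: "u \<in> carrier (Cc X)"
    by (rule M.Icarr)
  have nz: "u x \<noteq> 0" if x: "x \<in> topspace X" for x
  proof
    assume "u x = 0"
    then have "f x * f x + m x * m x = 0"
      using x by (simp add: u_def Cc_apply)
    then have "f x = 0" "m x = 0"
      by (simp_all add: sum_squares_eq_zero_iff)
    then have "g x = 0"
      using sub x by (auto simp: zero_set_def)
    moreover have "m x + h x * g x = 1"
      using fun_cong[OF eq, of x] x by (simp add: Cc_apply)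
    ultimately show False
      using \<open>m x = 0\<close> by simp
  qed
  define v where "v = (\<lambda>x\<in>topspace X. inverse (u x))"
  have "v \<in> carrier (Cc X)"
    unfolding v_def
  proof (rule Cc_closed_restrict)
    show "continuous_map X euclideanreal (\<lambda>x. inverse (u x))"
      using uC nz by (auto simp: Cc_simps intro: continuous_intros)
    show "countable ((\<lambda>x. inverse (u x)) ` topspace X)"
      using uC countable_image[of "u ` topspace X" inverse] by (simp add: Cc_simps image_image)
  qed
  then have "u \<otimes>\<^bsub>Cc X\<^esub> v \<in> M"
    using uM by (simp add: M.I_r_closed)
  moreover have "u \<otimes>\<^bsub>Cc X\<^esub> v = \<one>\<^bsub>Cc X\<^esub>"
    using nz by (auto simp: Cc_simps(2,4) v_def fun_eq_iff)
  ultimately show False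
    using M.one_imp_carrier M.I_notcarr by auto
qed

lemma openin_nonzero:
  assumes "continuous_map X euclideanreal f"
  shows "openin X {x \<in> topspace X. f x \<noteq> 0}"
  using openin_continuous_map_preimage[OF assms, of "- {0}"] by (simp add: open_Compl)

text \<open>The set where \<open>c\<close> is nonzero is open and contained in the zero set of
  \<open>a\<close>, so it is empty. Thus an element whose zero set has empty interior is
  regular.\<close>

lemma Cc_regular:
  assumes a: "X interior_of zero_set X a = {}" and c: "c \<in> carrier (Cc X)"
    and ac: "a \<otimes>\<^bsub>Cc X\<^esub> c = \<zero>\<^bsub>Cc X\<^esub>"
  shows "c = \<zero>\<^bsub>Cc X\<^esub>"
proof (rule Cc_eqI[OF c])
  show "\<zero>\<^bsub>Cc X\<^esub> \<in> carrier (Cc X)"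
    by (simp add: Cc_simps(5) Cc_const_closed)
  have "{x \<in> topspace X. c x \<noteq> 0} \<subseteq> zero_set X a"
  proof safe
    fix x assume x: "x \<in> topspace X" "c x \<noteq> 0"
    then show "x \<in> zero_set X a"
      using fun_cong[OF ac, of x] by (simp add: zero_set_def Cc_apply)
  qed
  then have "{x \<in> topspace X. c x \<noteq> 0} \<subseteq> X interior_of zero_set X a"
    using c by (simp add: interior_of_maximal openin_nonzero Cc_simps(1))
  then show "c x = \<zero>\<^bsub>Cc X\<^esub> x" if "x \<in> topspace X" for x
    using a that by (auto simp: Cc_apply)
qed

section \<open>Functions built from clopen sets\<close>

lemma zero_dimensional_space_base:
  assumes "zero_dimensional_space X" "openin X V" "x \<in> V"
  obtains U where "openin X U" "closedin X U" "x \<in> U" "U \<subseteq> V"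
proof -
  have "(arbitrary union_of (\<lambda>U. openin X U \<and> closedin X U)) V"
    using assms(1,2) by (simp add: zero_dimensional_space_def)
  then show ?thesis
    using assms(3) that by (auto simp: union_of_def arbitrary_def)
qed

text \<open>The epsilon form of continuity, suited to the step functions built below from clopen
  sets.\<close>

lemma continuous_map_real_locally:
  assumes "\<And>x e. x \<in> topspace X \<Longrightarrow> e > 0 \<Longrightarrow>
    \<exists>U. openin X U \<and> x \<in> U \<and> (\<forall>y\<in>U. dist (f x) (f y) < e)"
  shows "continuous_map X euclideanreal f"
proof -
  have "continuous_map X (Met_TC.mtopology) f"
    unfolding Met_TC.continuous_map_to_metric using assms by auto
  then show ?thesis
    by simp
qed

lemma Cc_indicator_closed:
  assumes "openin X U" "closedin X U"
  shows "(\<lambda>x\<in>topspace X. indicator U x) \<in> carrier (Cc X)"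
proof (rule Cc_closed_restrict)
  show "continuous_map X euclideanreal (indicator U)"
  proof (rule continuous_map_real_locally)
    fix x and e :: real assume "x \<in> topspace X" "e > 0"
    then show "\<exists>V. openin X V \<and> x \<in> V \<and> (\<forall>y\<in>V. dist (indicator U x) (indicator U y) < e)"
      using assms by (intro exI[of _ "if x \<in> U then U else topspace X - U"]) auto
  qed
  have "indicator U ` topspace X \<subseteq> {0, 1 :: real}"
    by (auto simp: indicator_def)
  then show "countable ((indicator U :: 'a \<Rightarrow> real) ` topspace X)"
    by (rule countable_subset) simp
qed

text \<open>Around \<open>x\<close>, choose clopen sets \<open>U n\<close> on which \<open>f\<close>
  is smaller than \<open>1/(n+1)\<close> in absolute value. The function \<open>a\<close> is 0 on
  their intersection and elsewhere \<open>1/(k+1)\<close>, where \<open>k\<close> is the first index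
  whose set omits the point. Its range is countable, and \<open>f\<close> vanishes wherever
  \<open>a\<close> does.\<close>

lemma Cc_zero_set_subset:
  assumes X: "zero_dimensional_space X" and f: "continuous_map X euclideanreal f"
    and x: "x \<in> zero_set X f"
  obtains a where "a \<in> carrier (Cc X)" "x \<in> zero_set X a" "zero_set X a \<subseteq> zero_set X f"
proof -
  have "\<exists>U. openin X U \<and> closedin X U \<and> x \<in> U \<and> U \<subseteq> {y \<in> topspace X. \<bar>f y\<bar> < inverse (Suc n)}" for n
  proof -
    have "openin X {y \<in> topspace X. f y \<in> {- inverse (Suc n)<..<inverse (Suc n)}}"
      by (rule openin_continuous_map_preimage[OF f]) simp
    also have "{y \<in> topspace X. f y \<in> {- inverse (Suc n)<..<inverse (Suc n)}}
        = {y \<in> topspace X. \<bar>f y\<bar> < inverse (Suc n)}"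
      by auto
    finally have op: "openin X {y \<in> topspace X. \<bar>f y\<bar> < inverse (Suc n)}" .
    have "x \<in> {y \<in> topspace X. \<bar>f y\<bar> < inverse (Suc n)}"
      using x by (simp add: zero_set_def)
    from zero_dimensional_space_base[OF X op this] show ?thesis
      by metis
  qed
  then obtain U where U: "\<And>n. openin X (U n)" "\<And>n. closedin X (U n)" "\<And>n. x \<in> U n"
    and Uf: "\<And>n y. y \<in> U n \<Longrightarrow> y \<in> topspace X \<and> \<bar>f y\<bar> < inverse (Suc n)"
    by (metis (mono_tags, lifting) mem_Collect_eq subsetD)
  \<comment> \<open>The value of \<open>k\<close> is meaningful only off the intersection of all
    \<open>U n\<close>, hence the case distinction in \<open>a\<close>.\<close>
  define k where "k y = (LEAST n. y \<notin> U n)" for y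
  define a where "a y = (if y \<in> (\<Inter>n. U n) then 0 else inverse (real (Suc (k y))))" for y
  have k: "y \<notin> U (k y)" if "y \<notin> (\<Inter>n. U n)" for y
    using that LeastI_ex[of "\<lambda>n. y \<notin> U n"] unfolding k_def by blast
  have k_eq: "k y = n" if "y \<notin> U n" "\<And>i. i < n \<Longrightarrow> y \<in> U i" for y n
    unfolding k_def using that by (intro Least_equality) (auto simp: not_less[symmetric])
  \<comment> \<open>Intersecting with \<open>topspace X\<close> handles \<open>n = 0\<close>, where
    the indexed intersection is the whole type.\<close>
  have op: "openin X (topspace X \<inter> (\<Inter>i\<in>{..<n}. U i))" for n
    using U(1) by (cases "n = 0") (auto intro!: openin_INT)
  have "continuous_map X euclideanreal a"
  proof (rule continuous_map_real_locally)
    fix y and e :: real assume y: "y \<in> topspace X" and e: "e > 0"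
    show "\<exists>V. openin X V \<and> y \<in> V \<and> (\<forall>z\<in>V. dist (a y) (a z) < e)"
    proof (cases "y \<in> (\<Inter>n. U n)")
      case True
      obtain n where n: "inverse (real (Suc n)) < e"
        using reals_Archimedean[OF e] by blast
      \<comment> \<open>A point of the first \<open>n\<close> sets leaves at index \<open>n\<close>
        or later, or never, so \<open>a\<close> is at most \<open>1/(n+1)\<close> there.\<close>
      have "dist (a y) (a z) < e" if z: "z \<in> topspace X \<inter> (\<Inter>i\<in>{..<n}. U i)" for z
      proof (cases "z \<in> (\<Inter>n. U n)")
        case False
        then have "n \<le> k z"
          using k[OF False] z by (meson INT_E IntD2 lessThan_iff not_less)
        then have "inverse (real (Suc (k z))) \<le> inverse (real (Suc n))"
          by (simp add: le_imp_inverse_le)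
        then have "inverse (real (Suc (k z))) < e"
          using n by linarith
        moreover have "a y = 0" "a z = inverse (real (Suc (k z)))"
          using True False by (simp_all only: a_def if_True if_False)
        ultimately show ?thesis
          by (simp add: dist_real_def)
      qed (use True e in \<open>simp add: a_def\<close>)
      then show ?thesis
        using op[of n] True y by blast
    next
      case False
      \<comment> \<open>These are the points with the same first exit index as \<open>y\<close>, so
        \<open>a\<close> is constant on this open set.\<close>
      let ?V = "(topspace X \<inter> (\<Inter>i\<in>{..<k y}. U i)) \<inter> (topspace X - U (k y))"
      have "openin X ?V"
        by (intro openin_Int[OF op] openin_diff[OF openin_topspace U(2)])
      moreover have "y \<in> U i" if "i < k y" for i
        using not_less_Least[of i "\<lambda>n. y \<notin> U n"] that unfolding k_def by blast
      then have "y \<in> ?V"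
        using y k[OF False] by simp
      moreover have "a z = a y" if "z \<in> ?V" for z
        using that False k_eq[of z "k y"] unfolding a_def by auto
      ultimately show ?thesis
        using e by (metis dist_self)
    qed
  qed
  moreover have "countable (a ` topspace X)"
  proof (rule countable_subset)
    show "a ` topspace X \<subseteq> insert 0 (range (\<lambda>n. inverse (real (Suc n))))"
      by (auto simp: a_def)
  qed simp
  ultimately have "restrict a (topspace X) \<in> carrier (Cc X)"
    by (rule Cc_closed_restrict)
  moreover have "x \<in> zero_set X (restrict a (topspace X))"
    using x U(3) by (simp add: zero_set_def a_def)
  moreover have "zero_set X (restrict a (topspace X)) \<subseteq> zero_set X f"
  proof
    fix y assume "y \<in> zero_set X (restrict a (topspace X))"
    then have y: "y \<in> topspace X" "\<And>n. y \<in> U n"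
      by (auto simp: zero_set_def a_def split: if_splits)
    have "f y = 0"
    proof (rule ccontr)
      assume "f y \<noteq> 0"
      then obtain n where "inverse (real (Suc n)) < \<bar>f y\<bar>"
        using reals_Archimedean[of "\<bar>f y\<bar>"] by auto
      then show False
        using Uf[OF y(2)[of n]] by simp
    qed
    then show "y \<in> zero_set X f"
      using y by (simp add: zero_set_def)
  qed
  ultimately show ?thesis
    using that by blast
qed

section \<open>Hulls and almost P-spaces\<close>

text \<open>Through \<open>maximalideal_zero_set\<close> this becomes the inclusion of the
  minimal-prime hull in the maximal hull.\<close>

lemma almost_P_space_minprime_hull:
  assumes X: "zero_dimensional_space X" and P: "almost_P_space X"
    and a: "a \<in> carrier (Cc X)" and g: "g \<in> minprime_hull (Cc X) a"
  shows "zero_set X a \<subseteq> zero_set X g"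
proof (rule ccontr)
  assume "\<not> zero_set X a \<subseteq> zero_set X g"
  then obtain x where x: "x \<in> topspace X" "a x = 0" "g x \<noteq> 0"
    by (auto simp: zero_set_def)
  interpret cring "Cc X" by (rule Cc_cring)
  have gC: "g \<in> carrier (Cc X)"
    using g by (simp add: minprime_hull_def)
  then have "openin X {x \<in> topspace X. g x \<noteq> 0}"
    by (simp add: openin_nonzero Cc_simps(1))
  then obtain U where U: "openin X U" "closedin X U" "x \<in> U" "U \<subseteq> {x \<in> topspace X. g x \<noteq> 0}"
    using zero_dimensional_space_base[OF X, of _ x] x by blast
  define i :: "'a \<Rightarrow> real" where "i = (\<lambda>x\<in>topspace X. indicator U x)"
  \<comment> \<open>Both summands are nonnegative on the space, so \<open>h\<close> vanishes exactly
    on \<open>zero_set X a \<inter> U\<close>. This makes the intersection a zero set, to which the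
    almost P property applies.\<close>
  define h where "h y = \<bar>a y\<bar> + (1 - i y)" for y
  have "i \<in> carrier (Cc X)"
    unfolding i_def by (rule Cc_indicator_closed[OF U(1,2)])
  then have "continuous_map X euclideanreal h"
    unfolding h_def using a by (auto simp: Cc_simps(1) intro!: continuous_intros)
  moreover have h: "zero_set X h = zero_set X a \<inter> U"
    using openin_subset[OF U(1)] by (auto simp: zero_set_def h_def i_def indicator_def)
  moreover have "x \<in> zero_set X a \<inter> U"
    using x U by (simp add: zero_set_def)
  ultimately have "X interior_of (zero_set X a \<inter> U) \<noteq> {}"
    using P unfolding almost_P_space_def by (metis empty_iff)
  then obtain y where y: "y \<in> X interior_of (zero_set X a \<inter> U)"
    by blast
  \<comment> \<open>The interior need not be closed; a clopen \<open>W\<close> inside it has a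
    continuous indicator.\<close>
  obtain W where W: "openin X W" "closedin X W" "y \<in> W" "W \<subseteq> X interior_of (zero_set X a \<inter> U)"
    using zero_dimensional_space_base[OF X openin_interior_of y] .
  then have WU: "W \<subseteq> zero_set X a \<inter> U"
    using interior_of_subset by fast
  define e where "e = (\<lambda>x\<in>topspace X. indicator W x :: real)"
  have e: "e \<in> carrier (Cc X)"
    unfolding e_def using W by (simp add: Cc_indicator_closed)
  have ae: "a \<otimes>\<^bsub>Cc X\<^esub> e = \<zero>\<^bsub>Cc X\<^esub>"
    using WU by (auto simp: Cc_simps(2,5) e_def zero_set_def indicator_def fun_eq_iff)
  have yX: "y \<in> topspace X" "g y \<noteq> 0" "e y \<noteq> 0"
    using W WU U openin_subset[OF W(1)] by (auto simp: e_def)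
  obtain Q where Q: "minimal_primeideal Q (Cc X)" "Q \<subseteq> point_ideal X y"
    using minimal_primeideal_below[OF maximalideal_prime[OF point_ideal_maximal[OF yX(1)]]] .
  interpret Q: primeideal Q "Cc X"
    using Q(1) by (simp add: minimal_primeideal_def)
  have "e \<notin> Q" "g \<notin> Q"
    using Q(2) yX by (auto simp: point_ideal_def)
  moreover have "a \<otimes>\<^bsub>Cc X\<^esub> e \<in> Q"
    unfolding ae by simp
  ultimately have "a \<in> Q"
    using a e Q.I_prime by blast
  then show False
    using g Q(1) \<open>g \<notin> Q\<close> by (auto simp: minprime_hull_def)
qed

lemma z_ideal_imp_z0_ideal:
  assumes X: "zero_dimensional_space X" "almost_P_space X" and I: "z_ideal I (Cc X)"
  shows "z0_ideal I (Cc X)"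
  unfolding z0_ideal_def
proof (intro conjI ballI subsetI)
  show proper: "proper_ideal I (Cc X)"
    using I by (simp add: z_ideal_def)
  fix a g assume a: "a \<in> I" and g: "g \<in> minprime_hull (Cc X) a"
  have aC: "a \<in> carrier (Cc X)"
    using proper a ideal.Icarr unfolding proper_ideal_def by metis
  have gC: "g \<in> carrier (Cc X)"
    using g by (simp add: minprime_hull_def)
  have "g \<in> max_hull (Cc X) a"
    using maximalideal_zero_set[OF _ _ gC almost_P_space_minprime_hull[OF X aC g]] gC
    by (auto simp: max_hull_def)
  then show "g \<in> I"
    using I a unfolding z_ideal_def by blast
qed

text \<open>\<open>M\<close> is itself one of the ideals intersected in \<open>max_hull R a\<close>
  when \<open>a \<in> M\<close>.\<close>

lemma maximalideal_imp_z_ideal: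
  assumes "maximalideal M R"
  shows "z_ideal M R"
  using assms maximalideal.axioms(1)[OF assms] maximalideal.I_notcarr[OF assms]
  by (auto simp: z_ideal_def proper_ideal_def max_hull_def)

text \<open>Only fixed maximal ideals are assumed to be \<open>z0_ideal\<close>s, so the lemma
  serves the converse direction of all three equivalences.\<close>

lemma almost_P_spaceI:
  assumes X: "zero_dimensional_space X"
    and fixd: "\<And>M. maximalideal M (Cc X) \<Longrightarrow> fixed_ideal X M \<Longrightarrow> z0_ideal M (Cc X)"
  shows "almost_P_space X"
  unfolding almost_P_space_def
proof (intro allI impI notI)
  fix f assume f: "continuous_map X euclideanreal f" and "zero_set X f \<noteq> {}"
    and int: "X interior_of zero_set X f = {}"
  then obtain x where x: "x \<in> zero_set X f"
    by blast
  interpret cring "Cc X" by (rule Cc_cring)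
  obtain a where a: "a \<in> carrier (Cc X)" "x \<in> zero_set X a" "zero_set X a \<subseteq> zero_set X f"
    using Cc_zero_set_subset[OF X f x] .
  have "X interior_of zero_set X a = {}"
    using interior_of_mono[OF a(3), of X] int by blast
  then have "a \<notin> P" if "minimal_primeideal P (Cc X)" for P
    using minimal_primeideal_no_regular[OF that a(1)] Cc_regular by blast
  \<comment> \<open>No minimal prime contains \<open>a\<close>, so the intersection is over the
    empty family and yields the whole ring.\<close>
  then have hull: "minprime_hull (Cc X) a = carrier (Cc X)"
    unfolding minprime_hull_def by blast
  have xX: "x \<in> topspace X" and ax: "a \<in> point_ideal X x"
    using a by (auto simp: zero_set_def point_ideal_def)
  have "fixed_ideal X (point_ideal X x)"
    using xX by (auto simp: fixed_ideal_def point_ideal_def)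
  then have "z0_ideal (point_ideal X x) (Cc X)"
    using fixd point_ideal_maximal[OF xX] by blast
  then have "carrier (Cc X) \<subseteq> point_ideal X x"
    using ax hull unfolding z0_ideal_def by metis
  then show False
    using one_closed xX by (auto simp: point_ideal_def Cc_simps(4))
qed

theorem theorem4p10:
  fixes X :: "'a topology"
  assumes "zero_dimensional_space X" and "Hausdorff_space X"
  shows "(almost_P_space X \<longleftrightarrow>
            (\<forall>M. maximalideal M (Cc X) \<longrightarrow> z0_ideal M (Cc X))) \<and>
         (almost_P_space X \<longleftrightarrow>
            (\<forall>M. maximalideal M (Cc X) \<longrightarrow> fixed_ideal X M \<longrightarrow> z0_ideal M (Cc X))) \<and>
         (almost_P_space X \<longleftrightarrow>
            (\<forall>I. z_ideal I (Cc X) \<longrightarrow> z0_ideal I (Cc X)))"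
  \<comment> \<open>The almost P property gives the statement on z-ideals, which specializes to
    maximal ideals and then to fixed ones; \<open>almost_P_spaceI\<close> closes the circle.\<close>
  using z_ideal_imp_z0_ideal[OF assms(1)] maximalideal_imp_z_ideal[of _ "Cc X"]
    almost_P_spaceI[OF assms(1)] by blast

end
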